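(* Let $C_m$ and $C_n$ be chains with $m\ge2$ and $n\ge2$ elements, respectively. Then the product poset $C_m\times C_n$ has a $1/3$-balanced pair.
   Context: $C_k$ denotes the totally ordered set with $k$ elements; $C_m\times C_n$ is ordered componentwise. For distinct $x,y$ in a finite poset $P$, $\mathbb{P}(x\prec y)$ is the proportion of linear extensions of $P$ (total orders compatible with the partial order) in which $x$ comes before $y$. A pair $(x,y)$ is $1/3$-balanced if $1/3\le\mathbb{P}(x\prec y)\le2/3$. *)

theory Defs
  imports Complex_Main "HOL-Library.Product_Order"
begin

text \<open>
  A poset is a carrier \<open>A\<close> with a reflexive order relation \<open>r \<subseteq> A \<times> A\<close> such that
  \<^term>\<open>partial_order_on A r\<close>.  Since \<^const>\<open>linear_order_on\<close> also forces \<open>L \<subseteq> A \<times> A\<close>,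
  distinct members of the following set are distinct total orders of \<open>A\<close>.
\<close>

definition linear_extensions :: "'a set \<Rightarrow> 'a rel \<Rightarrow> 'a rel set" where
  "linear_extensions A r = {L. linear_order_on A L \<and> r \<subseteq> L}"

text \<open>
  Linear extensions are reflexive relations, so \<open>(x, y) \<in> L\<close> says that \<open>x\<close> comes before \<open>y\<close>
  only for \<open>x \<noteq> y\<close>.  The quotient is meaningful for finite \<open>A\<close> only.
\<close>

definition prob_before :: "'a set \<Rightarrow> 'a rel \<Rightarrow> 'a \<Rightarrow> 'a \<Rightarrow> real" where
  "prob_before A r x y =
     real (card {L \<in> linear_extensions A r. (x, y) \<in> L}) / real (card (linear_extensions A r))"

definition third_balanced_pair :: "'a set \<Rightarrow> 'a rel \<Rightarrow> 'a \<Rightarrow> 'a \<Rightarrow> bool" where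
  "third_balanced_pair A r x y \<longleftrightarrow>
     x \<in> A \<and> y \<in> A \<and> x \<noteq> y \<and> 1 / 3 \<le> prob_before A r x y \<and> prob_before A r x y \<le> 2 / 3"

definition chain :: "nat \<Rightarrow> nat set" where
  "chain k = {..<k}"

text \<open>The order \<open>\<le>\<close> on pairs is the componentwise one from \<^theory>\<open>HOL-Library.Product_Order\<close>.\<close>

definition chain_prod_order :: "nat \<Rightarrow> nat \<Rightarrow> (nat \<times> nat) rel" where
  "chain_prod_order m n = relation_of (\<le>) (chain m \<times> chain n)"

lemma chain_prod_order_iff:
  "((a, b), (c, d)) \<in> chain_prod_order m n \<longleftrightarrow> a \<le> c \<and> b \<le> d \<and> c < m \<and> d < n"
  by (auto simp: chain_prod_order_def relation_of_def chain_def)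

lemma partial_order_on_chain_prod_order:
  "partial_order_on (chain m \<times> chain n) (chain_prod_order m n)"
  unfolding chain_prod_order_def by (rule partial_order_on_relation_ofI) auto

lemma finite_linear_extensions:
  assumes "finite A"
  shows "finite (linear_extensions A r)"
proof (rule finite_subset)
  show "linear_extensions A r \<subseteq> Pow (A \<times> A)"
    by (auto simp: linear_extensions_def order_on_defs)
  show "finite (Pow (A \<times> A))"
    using assms by simp
qed

end

theory Submission
  imports Defs
begin

text \<open>
  Give the cell \<open>(i, j)\<close> the content \<open>j - i\<close>.  In a random linear extension of \<open>C\<^sub>m \<times> C\<^sub>n\<close> the expected
  content of the \<open>k\<close>-th cell is an affine function of \<open>k\<close>: permuting only three consecutive cells
  in all admissible ways, the middle cell has on average the mean content of the three.  The first
  cell has content \<open>0\<close> and the last one \<open>n - m\<close>, so the second cell, which is \<open>(0, 1)\<close> or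
  \<open>(1, 0)\<close>, has expected content \<open>(n - m) / (m n - 1)\<close>.  If this is at most \<open>1 / 3\<close> in absolute
  value, \<open>(1, 0)\<close> and \<open>(0, 1)\<close> are balanced.  Otherwise one chain has two elements, say \<open>m = 2\<close>,
  and \<open>n \<ge> 6\<close>; then swapping the second and third cells shows that \<open>(1, 0)\<close> precedes \<open>(0, 2)\<close> exactly
  twice as often as it precedes \<open>(0, 1)\<close>, that is with probability \<open>(n + 1) / (2 n - 1)\<close>.
\<close>

section \<open>Linear extensions as lists\<close>

text \<open>The relation excludes repetitions too, because \<open>\<le>\<close> is reflexive.\<close>

definition lin_lists :: "'a::order set \<Rightarrow> 'a list set" where
  "lin_lists A = {xs. set xs = A \<and> sorted_wrt (\<lambda>x y. \<not> y \<le> x) xs}"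

fun list_rel :: "'a list \<Rightarrow> 'a rel" where
  "list_rel [] = {}"
| "list_rel (x # xs) = {x} \<times> set (x # xs) \<union> list_rel xs"

lemma list_rel_append:
  "list_rel (xs @ ys) = list_rel xs \<union> set xs \<times> set ys \<union> list_rel ys"
  by (induction xs) auto

lemma list_rel_subset: "list_rel xs \<subseteq> set xs \<times> set xs"
  by (induction xs) auto

lemma linear_order_list_rel:
  "distinct xs \<Longrightarrow> linear_order_on (set xs) (list_rel xs)"
proof (induction xs)
  case (Cons x xs)
  then show ?case using list_rel_subset[of xs]
    unfolding order_on_defs refl_on_def total_on_def
    by (intro conjI transI antisymI; simp; blast dest: transD antisymD)
qed (auto simp: order_on_defs refl_on_def total_on_def trans_def antisym_def)

lemma sorted_wrt_list_rel:
  "sorted_wrt P xs \<Longrightarrow> (x, y) \<in> list_rel xs \<Longrightarrow> x \<noteq> y \<Longrightarrow> P x y"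
  by (induction xs) auto

text \<open>A new element \<open>x\<close> is inserted by listing first what lies below it, then
  \<open>x\<close>, then the rest; by transitivity nothing in the rest lies below a member of the
  first part. For \<open>\<le>\<close> this yields the existence of an extension, for a total order
  the list that represents it.\<close>

lemma sorted_wrt_topological:
  assumes "finite A" "trans r" "antisym r"
  shows "\<exists>xs. set xs = A \<and> distinct xs \<and> sorted_wrt (\<lambda>x y. (y, x) \<notin> r) xs"
  using assms(1)
proof (induction A)
  case (insert x A)
  then obtain xs where xs: "set xs = A" "distinct xs" "sorted_wrt (\<lambda>x y. (y, x) \<notin> r) xs"
    by blast
  let ?ys = "filter (\<lambda>y. (y, x) \<in> r) xs @ x # filter (\<lambda>y. (y, x) \<notin> r) xs"
  have "sorted_wrt (\<lambda>x y. (y, x) \<notin> r) ?ys"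
    using xs insert.hyps assms(2,3)
    by (auto simp: sorted_wrt_append sorted_wrt_filter dest: transD antisymD)
  moreover have "set ?ys = insert x A" "distinct ?ys"
    using xs insert.hyps by auto
  ultimately show ?case by blast
qed auto

lemma lin_lists_distinct: "xs \<in> lin_lists A \<Longrightarrow> distinct xs"
proof -
  have "sorted_wrt (\<lambda>x y. \<not> y \<le> x) xs \<Longrightarrow> distinct xs" by (induction xs) auto
  then show "xs \<in> lin_lists A \<Longrightarrow> distinct xs" by (simp add: lin_lists_def)
qed

lemma lin_lists_length: "xs \<in> lin_lists A \<Longrightarrow> length xs = card A"
  using lin_lists_distinct distinct_card by (fastforce simp: lin_lists_def)

lemma finite_lin_lists: "finite A \<Longrightarrow> finite (lin_lists A)"
  by (rule finite_subset[OF _ finite_lists_length_eq[of A "card A"]])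
    (auto simp: lin_lists_length, auto simp: lin_lists_def)

lemma lin_lists_nonempty:
  assumes "finite A"
  shows "lin_lists A \<noteq> {}"
  using sorted_wrt_topological[OF assms, of "{(x, y). x \<le> y}"]
  by (force simp: lin_lists_def trans_def antisym_def)

text \<open>The head is the least element of the relation, so the heads agree; restricting the
  relation to the remaining elements gives the relation of the tail.\<close>

lemma list_rel_inj:
  "\<lbrakk>list_rel xs = list_rel ys; distinct xs; distinct ys; set xs = set ys\<rbrakk> \<Longrightarrow> xs = ys"
proof (induction xs arbitrary: ys)
  case (Cons x xs)
  then obtain y zs where ys: "ys = y # zs" by (cases ys) auto
  have "y \<in> set (x # xs)" "x \<in> set (y # zs)"
    using Cons.prems(4) ys by auto
  then have "(x, y) \<in> list_rel (x # xs)" "(y, x) \<in> list_rel (y # zs)"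
    by auto
  then have "(y, x) \<in> list_rel (x # xs)" "(x, y) \<in> list_rel (x # xs)"
    using Cons.prems(1) unfolding ys by (simp_all del: list_rel.simps)
  then have y: "y = x"
    using linear_order_list_rel[OF Cons.prems(2)] by (auto simp: order_on_defs antisym_def)
  have x: "x \<notin> set xs" "x \<notin> set zs"
    using Cons.prems ys y by auto
  have eq: "list_rel us = list_rel (x # us) \<inter> set us \<times> set us" if "x \<notin> set us" for us
    using that list_rel_subset[of us] by auto
  have "set xs = set zs"
    using Cons.prems(4) ys y x by auto
  moreover have "list_rel xs = list_rel zs"
    using eq[OF x(1)] eq[OF x(2)] Cons.prems(1) ys y calculation by metis
  ultimately show ?case
    using Cons.IH Cons.prems ys y by simp
qed auto

lemma bij_betw_list_rel:
  assumes "finite A"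
  shows "bij_betw list_rel (lin_lists A) (linear_extensions A (relation_of (\<le>) A))"
  unfolding bij_betw_def
proof (intro conjI subset_antisym subsetI)
  show "inj_on list_rel (lin_lists A)"
  proof (rule inj_onI)
    fix xs ys assume "xs \<in> lin_lists A" "ys \<in> lin_lists A" "list_rel xs = list_rel ys"
    then show "xs = ys"
      by (intro list_rel_inj) (auto dest: lin_lists_distinct, auto simp: lin_lists_def)
  qed
next
  fix L assume "L \<in> list_rel ` lin_lists A"
  then obtain xs where xs: "xs \<in> lin_lists A" "L = list_rel xs" by auto
  have lin: "linear_order_on A L"
    using linear_order_list_rel[OF lin_lists_distinct[OF xs(1)]] xs by (auto simp: lin_lists_def)
  have "(x, y) \<in> L" if "x \<in> A" "y \<in> A" "x \<le> y" for x y
  proof (cases "x = y")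
    case True
    then show ?thesis using lin that by (auto simp: order_on_defs refl_on_def)
  next
    case False
    then have "(x, y) \<in> L \<or> (y, x) \<in> L"
      using lin that by (auto simp: order_on_defs total_on_def)
    moreover have "(y, x) \<notin> L"
      using sorted_wrt_list_rel[of "\<lambda>x y. \<not> y \<le> x" xs y x] xs that False
      by (auto simp: lin_lists_def)
    ultimately show ?thesis by blast
  qed
  then show "L \<in> linear_extensions A (relation_of (\<le>) A)"
    using lin by (auto simp: linear_extensions_def relation_of_def)
next
  fix L assume "L \<in> linear_extensions A (relation_of (\<le>) A)"
  then have L: "linear_order_on A L" "relation_of (\<le>) A \<subseteq> L"
    by (auto simp: linear_extensions_def)
  then obtain xs where xs: "set xs = A" "distinct xs" "sorted_wrt (\<lambda>x y. (y, x) \<notin> L) xs"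
    using sorted_wrt_topological[OF assms, of L] by (auto simp: order_on_defs)
  have lin: "linear_order_on A (list_rel xs)"
    using linear_order_list_rel xs by blast
  have "list_rel xs \<subseteq> L"
  proof clarify
    fix x y assume xy: "(x, y) \<in> list_rel xs"
    then have "x \<in> A" "y \<in> A" using list_rel_subset xs by fastforce+
    then show "(x, y) \<in> L"
      using sorted_wrt_list_rel[OF xs(3) xy] L(1)
      by (cases "x = y") (auto simp: order_on_defs refl_on_def total_on_def)
  qed
  \<comment> \<open>Of two nested linear orders on \<open>A\<close> neither is larger: a pair of
    \<open>L\<close> missing from \<open>list_rel xs\<close> occurs there reversed, against
    antisymmetry of \<open>L\<close>.\<close>
  moreover have "L \<subseteq> list_rel xs"
    using calculation L(1) lin
    by (auto simp: order_on_defs refl_on_def total_on_def antisym_def) (metis subsetD mem_Sigma_iff)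
  ultimately have "L = list_rel xs" by blast
  moreover have "sorted_wrt (\<lambda>x y. \<not> y \<le> x) xs"
    using xs L(2) by (intro sorted_wrt_mono_rel[OF _ xs(3)]) (auto simp: relation_of_def)
  ultimately show "L \<in> list_rel ` lin_lists A"
    using xs by (auto simp: lin_lists_def)
qed

lemma prob_before_lin_lists:
  assumes "finite A"
  shows "prob_before A (relation_of (\<le>) A) x y =
    real (card {xs \<in> lin_lists A. (x, y) \<in> list_rel xs}) / real (card (lin_lists A))"
proof -
  let ?E = "linear_extensions A (relation_of (\<le>) A)"
  note bij = bij_betw_list_rel[OF assms]
  have "bij_betw list_rel {xs \<in> lin_lists A. (x, y) \<in> list_rel xs} {L \<in> ?E. (x, y) \<in> L}"
    by (rule bij_betw_subset[OF bij]) (use bij in \<open>auto simp: bij_betw_def\<close>)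
  then show ?thesis
    using bij_betw_same_card[OF bij] by (simp add: prob_before_def bij_betw_same_card)
qed

section \<open>Rearranging three consecutive entries\<close>

text \<open>Each element outside the window is compared with all three entries in the same
  direction, so those conditions depend only on the set of entries. Only the order inside the window
  has to be checked.\<close>

lemma lin_lists_window_iff:
  assumes "us @ [p, q, r] @ vs \<in> lin_lists A"
  shows "us @ [p', q', r'] @ vs \<in> lin_lists A \<longleftrightarrow>
    {p', q', r'} = {p, q, r} \<and> \<not> q' \<le> p' \<and> \<not> r' \<le> p' \<and> \<not> r' \<le> q'" (is "?L \<longleftrightarrow> ?R")
proof
  assume L: ?L
  have "{p', q', r'} = A - set us - set vs"
    using L lin_lists_distinct[OF L] by (auto simp: lin_lists_def)
  moreover have "{p, q, r} = A - set us - set vs"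
    using assms lin_lists_distinct[OF assms] by (auto simp: lin_lists_def)
  ultimately show ?R using L by (auto simp: lin_lists_def sorted_wrt_append)
next
  assume R: ?R
  then have e: "\<And>P. P p' \<and> P q' \<and> P r' \<longleftrightarrow> P p \<and> P q \<and> P r"
    by (metis insertE insert_iff singletonD)
  show ?L
    using assms R e[of "\<lambda>z. \<forall>u\<in>set us. \<not> z \<le> u"] e[of "\<lambda>z. \<forall>v\<in>set vs. \<not> v \<le> z"]
    by (simp add: lin_lists_def sorted_wrt_append) blast
qed

text \<open>Nothing above the \<open>k\<close>-th entry can stand before it. For the last position
  this forces the last entry to be the maximum of the grid.\<close>

lemma lin_lists_nth_above:
  assumes "xs \<in> lin_lists A" "x \<in> A" "k < length xs" "xs ! k \<le> x"
  obtains i where "k \<le> i" "i < length xs" "xs ! i = x"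
proof -
  obtain i where i: "i < length xs" "xs ! i = x"
    using assms(1,2) by (auto simp: lin_lists_def in_set_conv_nth)
  then have "k \<le> i"
    using assms sorted_wrt_nth_less[of _ xs i k] by (force simp: lin_lists_def not_le[symmetric])
  with i that show ?thesis by blast
qed

section \<open>Contents along covers in the grid\<close>

definition content :: "nat \<times> nat \<Rightarrow> int" where
  "content x = int (snd x) - int (fst x)"

text \<open>The hypotheses say that \<open>q\<close> covers \<open>p\<close>. Raising by one a
  coordinate in which \<open>q\<close> exceeds \<open>p\<close> gives a cell between the two other
  than \<open>p\<close>, hence \<open>q\<close> itself.\<close>

lemma grid_cover_cases:
  fixes p q :: "nat \<times> nat"
  assumes "p \<le> q" "p \<noteq> q" "\<And>w. p \<le> w \<Longrightarrow> w \<le> q \<Longrightarrow> w = p \<or> w = q"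
  shows "q = (fst p + 1, snd p) \<or> q = (fst p, snd p + 1)"
proof (cases "fst p < fst q")
  case True
  then show ?thesis
    using assms(1) assms(3)[of "(fst p + 1, snd p)"] by (auto simp: less_eq_prod_def prod_eq_iff)
next
  case False
  then show ?thesis
    using assms(1,2) assms(3)[of "(fst p, snd p + 1)"] by (auto simp: less_eq_prod_def prod_eq_iff)
qed

text \<open>Two incomparable covers of \<open>p\<close> are its two neighbours in different
  directions; one raises the content by 1, the other lowers it by 1.\<close>

lemma content_fork:
  assumes "p \<le> q" "p \<le> r" "p \<noteq> q" "p \<noteq> r" "\<not> q \<le> r" "\<not> r \<le> q"
    and "\<And>w. p \<le> w \<Longrightarrow> w \<le> q \<or> w \<le> r \<Longrightarrow> w \<in> {p, q, r}"
  shows "content q + content r = 2 * content p"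
proof -
  have "q = (fst p + 1, snd p) \<or> q = (fst p, snd p + 1)"
    using assms by (intro grid_cover_cases) blast+
  moreover have "r = (fst p + 1, snd p) \<or> r = (fst p, snd p + 1)"
    using assms by (intro grid_cover_cases) blast+
  ultimately show ?thesis
    using assms by (auto simp: content_def)
qed

lemma content_join:
  assumes "p \<le> r" "q \<le> r" "p \<noteq> r" "q \<noteq> r" "\<not> p \<le> q" "\<not> q \<le> p"
    and "\<And>w. w \<le> r \<Longrightarrow> p \<le> w \<or> q \<le> w \<Longrightarrow> w \<in> {p, q, r}"
  shows "content p + content q = 2 * content r"
proof -
  have "r = (fst p + 1, snd p) \<or> r = (fst p, snd p + 1)"
    using assms by (intro grid_cover_cases) blast+
  moreover have "r = (fst q + 1, snd q) \<or> r = (fst q, snd q + 1)"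
    using assms by (intro grid_cover_cases) blast+
  ultimately show ?thesis
    using assms(5,6) by (auto simp: content_def prod_eq_iff less_eq_prod_def)
qed

text \<open>The two covering steps cannot turn: steps in different directions would span a square
  whose fourth cell also lies between \<open>p\<close> and \<open>r\<close>. So both change the
  content by the same amount.\<close>

lemma content_chain:
  assumes "p \<le> q" "q \<le> r" "p \<noteq> q" "q \<noteq> r"
    and between: "\<And>w. p \<le> w \<Longrightarrow> w \<le> r \<Longrightarrow> w \<in> {p, q, r}"
  shows "content p + content r = 2 * content q"
proof -
  have "q = (fst p + 1, snd p) \<or> q = (fst p, snd p + 1)"
    using assms by (intro grid_cover_cases) (auto dest: order_trans antisym)
  moreover have "r = (fst q + 1, snd q) \<or> r = (fst q, snd q + 1)"
    using assms by (intro grid_cover_cases) (auto dest: order_trans antisym)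
  ultimately show ?thesis
    using between[of "(fst p + 1, snd p)"] between[of "(fst p, snd p + 1)"]
    by (auto simp: content_def less_eq_prod_def prod_eq_iff)
qed

text \<open>With no relation among the three cells all six orders are admissible, with one relation
  three are, and the contents cancel identically. Two relations form a fork or a join and leave two
  orders; a chain leaves one. Convexity turns the relations there into covers, and the content
  identities give zero.\<close>

lemma content_window_sum:
  assumes pqr: "\<not> q \<le> p" "\<not> r \<le> p" "\<not> r \<le> q"
    and convex: "\<And>x w y. x \<in> {p, q, r} \<Longrightarrow> y \<in> {p, q, r} \<Longrightarrow> x \<le> w \<Longrightarrow> w \<le> y \<Longrightarrow> w \<in> {p, q, r}"
  shows "(\<Sum>(a, b, c) \<in> {(a, b, c). {a, b, c} = {p, q, r} \<and> \<not> b \<le> a \<and> \<not> c \<le> a \<and> \<not> c \<le> b}.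
    content a + content c - 2 * content b) = 0" (is "sum ?g ?W = 0")
proof -
  let ?T = "{(p, q, r), (p, r, q), (q, p, r), (q, r, p), (r, p, q), (r, q, p)}"
  have ne: "p \<noteq> q" "p \<noteq> r" "q \<noteq> r" "q \<noteq> p" "r \<noteq> p" "r \<noteq> q"
    using pqr by auto
  \<comment> \<open>Written as a filter of six explicit triples, the sum becomes six conditional
    terms that the three comparisons decide.\<close>
  have "?W = {t \<in> ?T. case t of (a, b, c) \<Rightarrow> \<not> b \<le> a \<and> \<not> c \<le> a \<and> \<not> c \<le> b}"
    (is "_ = {t \<in> ?T. ?ok t}")
  proof -
    have "{a, b, c} = {p, q, r} \<longleftrightarrow> (a, b, c) \<in> ?T" for a b c
    proof
      assume e: "{a, b, c} = {p, q, r}"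
      then have "a \<in> {p, q, r}" "b \<in> {p, q, r}" "c \<in> {p, q, r}"
        "p \<in> {a, b, c}" "q \<in> {a, b, c}" "r \<in> {a, b, c}"
        by blast+
      then show "(a, b, c) \<in> ?T" using ne by auto
    qed auto
    then show ?thesis by auto
  qed
  then have "sum ?g ?W = (\<Sum>t\<in>?T. if ?ok t then ?g t else 0)"
    by (simp only: sum.inter_filter finite.intros)
  also have "\<dots> = 0"
  proof -
    have fork: "content q + content r = 2 * content p" if "p \<le> q" "p \<le> r" "\<not> q \<le> r"
      using that pqr ne convex by (intro content_fork) blast+
    have join: "content p + content q = 2 * content r" if "p \<le> r" "q \<le> r" "\<not> p \<le> q"
      using that pqr ne convex by (intro content_join) blast+
    have chain: "content p + content r = 2 * content q" if "p \<le> q" "q \<le> r"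
      using that pqr ne convex by (intro content_chain) blast+
    have tr: "p \<le> q \<Longrightarrow> q \<le> r \<Longrightarrow> p \<le> r" by (rule order_trans)
    show ?thesis
      using pqr ne fork join chain tr
      by (cases "p \<le> q"; cases "p \<le> r"; cases "q \<le> r") simp_all
  qed
  finally show ?thesis .
qed

section \<open>The total content is affine in the position\<close>

lemma content_sum_second_difference:
  assumes fin: "finite A"
    and convex: "\<And>x w y. x \<in> A \<Longrightarrow> y \<in> A \<Longrightarrow> x \<le> w \<Longrightarrow> w \<le> y \<Longrightarrow> w \<in> A"
    and k: "k + 2 < card A"
  shows "(\<Sum>xs\<in>lin_lists A. content (xs ! k) + content (xs ! (k + 2)) - 2 * content (xs ! (k + 1))) = 0"
    (is "sum ?g ?L = 0")
proof -
  let ?h = "\<lambda>xs. (take k xs, drop (k + 3) xs)"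
  \<comment> \<open>Extensions are grouped by their entries outside positions \<open>k\<close> to
    \<open>k + 2\<close>; each group consists of all admissible orders of one window.\<close>
  have "sum ?g {xs \<in> ?L. ?h xs = y} = 0" if "y \<in> ?h ` ?L" for y
  proof -
    from that obtain zs where zs: "zs \<in> ?L" "y = ?h zs" by blast
    let ?us = "take k zs" and ?vs = "drop (k + 3) zs"
    let ?p = "zs ! k" and ?q = "zs ! (k + 1)" and ?r = "zs ! (k + 2)"
    have win: "xs = take k xs @ [xs ! k, xs ! (k + 1), xs ! (k + 2)] @ drop (k + 3) xs"
      if "xs \<in> ?L" for xs
      using k lin_lists_length[OF that]
      by (simp add: Cons_nth_drop_Suc numeral_eq_Suc)
    have win_zs: "?us @ [?p, ?q, ?r] @ ?vs \<in> ?L"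
      using win[OF zs(1)] zs(1) by simp
    have len: "length ?us = k"
      using k lin_lists_length[OF zs(1)] by simp
    let ?W = "{(a, b, c). {a, b, c} = {?p, ?q, ?r} \<and> \<not> b \<le> a \<and> \<not> c \<le> a \<and> \<not> c \<le> b}"
    let ?f = "\<lambda>(a, b, c). ?us @ [a, b, c] @ ?vs"
    have fiber: "{xs \<in> ?L. ?h xs = y} = ?f ` ?W"
    proof (intro subset_antisym subsetI)
      fix xs assume "xs \<in> {xs \<in> ?L. ?h xs = y}"
      then have xs: "xs \<in> ?L" "take k xs = ?us" "drop (k + 3) xs = ?vs"
        using zs by auto
      have e: "xs = ?us @ [xs ! k, xs ! (k + 1), xs ! (k + 2)] @ ?vs"
        using win[OF xs(1)] unfolding xs(2,3) .
      with xs(1) have "?us @ [xs ! k, xs ! (k + 1), xs ! (k + 2)] @ ?vs \<in> ?L" by simp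
      then have "(xs ! k, xs ! (k + 1), xs ! (k + 2)) \<in> ?W"
        using lin_lists_window_iff[OF win_zs] by simp
      moreover have "xs = ?f (xs ! k, xs ! (k + 1), xs ! (k + 2))"
        using e unfolding prod.case .
      ultimately show "xs \<in> ?f ` ?W" by (rule rev_image_eqI)
    next
      fix xs assume "xs \<in> ?f ` ?W"
      then obtain a b c where abc: "(a, b, c) \<in> ?W" "xs = ?us @ [a, b, c] @ ?vs" by auto
      then have "xs \<in> ?L" using lin_lists_window_iff[OF win_zs] by simp
      then show "xs \<in> {xs \<in> ?L. ?h xs = y}" using abc(2) len zs(2) by simp
    qed
    have "sum ?g {xs \<in> ?L. ?h xs = y} = (\<Sum>t\<in>?W. ?g (?f t))"
      unfolding fiber by (rule sum.reindex_cong[OF _ refl]) (auto simp: inj_on_def)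
    also have "\<dots> = (\<Sum>(a, b, c)\<in>?W. content a + content c - 2 * content b)"
      using len by (intro sum.cong) (auto simp: nth_append)
    also have "\<dots> = 0"
    proof (rule content_window_sum)
      show "\<not> ?q \<le> ?p" "\<not> ?r \<le> ?p" "\<not> ?r \<le> ?q"
        using win_zs by (auto simp: lin_lists_def sorted_wrt_append)
    next
      fix x w y assume *: "x \<in> {?p, ?q, ?r}" "y \<in> {?p, ?q, ?r}" "x \<le> w" "w \<le> y"
      \<comment> \<open>Convexity of \<open>A\<close> keeps \<open>w\<close> in \<open>A\<close>.
        Being above a window entry it is not in the prefix, being below one it is not in the
        suffix.\<close>
      have A: "A = set ?us \<union> {?p, ?q, ?r} \<union> set ?vs"
        using win_zs by (auto simp: lin_lists_def)
      then have "x \<in> A" "y \<in> A" using * by blast+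
      with * convex have "w \<in> A" by blast
      moreover have "\<forall>u\<in>set ?us. \<forall>z\<in>{?p, ?q, ?r}. \<not> z \<le> u"
        "\<forall>z\<in>{?p, ?q, ?r}. \<forall>v\<in>set ?vs. \<not> v \<le> z"
        using win_zs by (auto simp: lin_lists_def sorted_wrt_append)
      ultimately show "w \<in> {?p, ?q, ?r}"
        using A * by blast
    qed
    finally show ?thesis .
  qed
  then have "(\<Sum>y\<in>?h ` ?L. sum ?g {xs \<in> ?L. ?h xs = y}) = 0"
    by (rule sum.neutral[OF ballI])
  moreover have "finite ?L" by (rule finite_lin_lists[OF fin])
  ultimately show ?thesis
    using sum.group[of ?L "?h ` ?L" ?h ?g] by simp
qed

lemma linear_if_second_difference_zero:
  fixes S :: "nat \<Rightarrow> int"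
  assumes "\<And>k. k + 2 < N \<Longrightarrow> S k + S (k + 2) - 2 * S (k + 1) = 0" "S 0 = 0"
  shows "k < N \<Longrightarrow> S k = int k * S 1"
proof (induction k rule: less_induct)
  case (less k)
  consider "k = 0" | "k = 1" | j where "k = j + 2"
    by (metis One_nat_def add_2_eq_Suc' not0_implies_Suc)
  then show ?case
  proof cases
    case (3 j)
    then show ?thesis
      using less.IH[of j] less.IH[of "j + 1"] less.prems assms(1)[of j] by (simp add: algebra_simps)
  qed (use assms(2) in auto)
qed

section \<open>The second cell of an extension of the grid\<close>

lemma card_chain [simp]: "card (chain k) = k"
  by (simp add: chain_def)

lemma finite_chain [simp]: "finite (chain k)"
  by (simp add: chain_def)

text \<open>The least cell comes first, and every other cell lies above \<open>(0, 1)\<close> or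
  \<open>(1, 0)\<close>, so one of these comes next.\<close>

lemma lin_lists_chain_prod_cases:
  assumes "m \<ge> 2" "n \<ge> 2" and L: "xs \<in> lin_lists (chain m \<times> chain n)"
  obtains ws where "xs = (0, 0) # (0, 1) # ws" | ws where "xs = (0, 0) # (1, 0) # ws"
proof -
  have "length xs \<ge> 2 * 2"
    using assms(1,2) mult_le_mono[of 2 m 2 n] lin_lists_length[OF L] by simp
  then obtain x y ws where xs: "xs = x # y # ws"
    by (cases xs; cases "tl xs") auto
  have set: "set xs = {..<m} \<times> {..<n}" and sorted: "\<forall>w\<in>set (y # ws). \<not> w \<le> x" "\<forall>w\<in>set ws. \<not> w \<le> y"
    using L xs by (auto simp: lin_lists_def chain_def)
  have "(0, 0) \<in> set xs" "(0, 1) \<in> set xs" "(1, 0) \<in> set xs"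
    using assms(1,2) set by auto
  then have x: "x = (0, 0)" and y: "(0, 1) \<le> y \<Longrightarrow> y = (0, 1)" "(1, 0) \<le> y \<Longrightarrow> y = (1, 0)"
    using xs sorted by (auto simp: less_eq_prod_def)
  moreover have "y \<noteq> (0, 0)"
    using sorted(1) x by auto
  ultimately have "y = (0, 1) \<or> y = (1, 0)"
    by (cases y) auto
  with that xs x show ?thesis by blast
qed

lemma lin_lists_chain_prod_before_iff:
  assumes "m \<ge> 2" "n \<ge> 2" and L: "xs \<in> lin_lists (chain m \<times> chain n)"
  shows "((1, 0), (0, 1)) \<in> list_rel xs \<longleftrightarrow> xs ! 1 = (1, 0)"
    and "((0, 1), (1, 0)) \<in> list_rel xs \<longleftrightarrow> xs ! 1 = (0, 1)"
proof -
  have d: "distinct xs" by (rule lin_lists_distinct[OF L])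
  have "(0, 1) \<in> set xs" "(1, 0) \<in> set xs"
    using assms by (auto simp: lin_lists_def chain_def)
  then show "((1, 0), (0, 1)) \<in> list_rel xs \<longleftrightarrow> xs ! 1 = (1, 0)"
    and "((0, 1), (1, 0)) \<in> list_rel xs \<longleftrightarrow> xs ! 1 = (0, 1)"
    using list_rel_subset d by (cases rule: lin_lists_chain_prod_cases[OF assms]; fastforce)+
qed

text \<open>\<open>X\<close> and \<open>Y\<close> count the extensions with second cell
  \<open>(1, 0)\<close>, of content -1, and \<open>(0, 1)\<close>, of content 1. The second equation
  evaluates the affine total content at the last position, counted from 0, with slope
  \<open>Y - X\<close>.\<close>

lemma card_lin_lists_chain_prod:
  assumes "m \<ge> 2" "n \<ge> 2"
  defines "L \<equiv> lin_lists (chain m \<times> chain n)"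
  defines "X \<equiv> card {xs \<in> L. ((1, 0), (0, 1)) \<in> list_rel xs}"
    and "Y \<equiv> card {xs \<in> L. ((0, 1), (1, 0)) \<in> list_rel xs}"
  shows "X + Y = card L"
    and "(int m * int n - 1) * (int Y - int X) = (int n - int m) * int (card L)"
proof -
  have fin: "finite L"
    unfolding L_def by (intro finite_lin_lists) simp
  let ?X = "{xs \<in> L. xs ! 1 = (1, 0)}" and ?Y = "{xs \<in> L. xs ! 1 = (0, 1)}"
  have "{xs \<in> L. ((1, 0), (0, 1)) \<in> list_rel xs} = ?X"
    "{xs \<in> L. ((0, 1), (1, 0)) \<in> list_rel xs} = ?Y"
    using lin_lists_chain_prod_before_iff[OF assms(1,2)] by (auto simp: L_def)
  then have XY: "X = card ?X" "Y = card ?Y"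
    by (simp_all add: X_def Y_def)
  have second: "xs ! 1 = (1, 0) \<or> xs ! 1 = (0, 1)" if "xs \<in> L" for xs
    using that unfolding L_def by (cases rule: lin_lists_chain_prod_cases[OF assms(1,2)]) auto
  then have split: "L = ?X \<union> ?Y" by blast
  have disj: "?X \<inter> ?Y = {}" by auto
  show "X + Y = card L"
    using card_Un_disjoint[of ?X ?Y] fin disj unfolding XY by (subst (3) split) simp
  define S where "S k = (\<Sum>xs\<in>L. content (xs ! k))" for k
  have N: "m * n \<ge> 4"
    using mult_le_mono[OF assms(1,2)] by simp
  have S: "S k = int k * S 1" if "k < m * n" for k
  proof (rule linear_if_second_difference_zero[OF _ _ that])
    fix k assume "k + 2 < m * n"
    then have "(\<Sum>xs\<in>L. content (xs ! k) + content (xs ! (k + 2)) - 2 * content (xs ! (k + 1))) = 0"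
      unfolding L_def
      by (intro content_sum_second_difference)
        (auto simp: chain_def less_eq_prod_def)
    then show "S k + S (k + 2) - 2 * S (k + 1) = 0"
      by (simp add: S_def sum.distrib sum_subtractf sum_distrib_left)
  next
    have "content (xs ! 0) = 0" if "xs \<in> L" for xs
      using that unfolding L_def
      by (cases rule: lin_lists_chain_prod_cases[OF assms(1,2)]) (auto simp: content_def)
    then show "S 0 = 0" by (simp add: S_def)
  qed
  \<comment> \<open>The last cell is the maximum \<open>(m - 1, n - 1)\<close>, of content
    \<open>(n - 1) - (m - 1)\<close>.\<close>
  have "content (xs ! (m * n - 1)) = int n - int m" if xs: "xs \<in> L" for xs
  proof -
    have len: "length xs = m * n"
      using lin_lists_length[OF xs[unfolded L_def]] by simp
    then have "xs ! (m * n - 1) \<in> set xs"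
      using N by (intro nth_mem) simp
    moreover have "set xs = chain m \<times> chain n"
      using xs by (simp add: L_def lin_lists_def)
    moreover have "z \<le> (m - 1, n - 1)" if "z \<in> chain m \<times> chain n" for z
      using that by (auto simp: chain_def less_eq_prod_def)
    ultimately have le: "xs ! (m * n - 1) \<le> (m - 1, n - 1)"
      by simp
    have mem: "xs \<in> lin_lists (chain m \<times> chain n)" "(m - 1, n - 1) \<in> chain m \<times> chain n"
      using xs assms(1,2) by (auto simp: L_def chain_def)
    have "m * n - 1 < length xs"
      using len N by simp
    then obtain i where "m * n - 1 \<le> i" "i < length xs" "xs ! i = (m - 1, n - 1)"
      using lin_lists_nth_above[OF mem _ le] by blast
    moreover from this have "i = m * n - 1" using len by simp
    ultimately show ?thesis
      using assms(1,2) by (auto simp: content_def)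
  qed
  then have "S (m * n - 1) = (int n - int m) * int (card L)"
    by (simp add: S_def)
  moreover have "int (m * n - 1) = int m * int n - 1"
    using N by (subst of_nat_diff, linarith) simp
  moreover have "S 1 = int Y - int X"
  proof -
    have "S 1 = (\<Sum>xs\<in>?X. content (xs ! 1)) + (\<Sum>xs\<in>?Y. content (xs ! 1))"
      unfolding S_def by (subst split) (rule sum.union_disjoint, use fin disj in auto)
    also have "(\<Sum>xs\<in>?X. content (xs ! 1)) = - int (card ?X)"
      by (simp add: content_def)
    also have "(\<Sum>xs\<in>?Y. content (xs ! 1)) = int (card ?Y)"
      by (simp add: content_def)
    finally show ?thesis by (simp add: XY)
  qed
  ultimately show "(int m * int n - 1) * (int Y - int X) = (int n - int m) * int (card L)"
    using S[of "m * n - 1"] N by (metis diff_less less_le_trans zero_less_numeral zero_less_one)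
qed

section \<open>Doubling by a swap in the two-row case\<close>

text \<open>An extension starts with \<open>o', a, b\<close>, with \<open>o', b, a\<close> or with
  \<open>o', b, d\<close>. Swapping \<open>a\<close> and \<open>b\<close> matches the first two
  kinds; both put \<open>a\<close> before \<open>d\<close>, but only the first puts \<open>a\<close>
  before \<open>b\<close>. The abstract setting covers both a grid with two rows and its
  transpose.\<close>

lemma card_lin_lists_double:
  fixes A :: "'a::order set"
  assumes fin: "finite A" and mem: "{o', a, b, d} \<subseteq> A"
    and distinct: "distinct [o', a, b, d]"
    and bottom: "\<And>x. x \<in> A \<Longrightarrow> o' \<le> x"
    and above_b: "\<And>x. x \<in> A - {o', a} \<Longrightarrow> b \<le> x"
    and above_a_or_d: "\<And>x. x \<in> A - {o', a, b} \<Longrightarrow> a \<le> x \<or> d \<le> x"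
    and incomp: "\<not> a \<le> b" "\<not> b \<le> a" "\<not> d \<le> a"
  shows "card {xs \<in> lin_lists A. (a, d) \<in> list_rel xs} =
    2 * card {xs \<in> lin_lists A. (a, b) \<in> list_rel xs}"
proof -
  let ?P = "{vs. [] @ [o', a, b] @ vs \<in> lin_lists A}"
  let ?f = "\<lambda>vs. o' # a # b # vs" and ?g = "\<lambda>vs. o' # b # a # vs"
  have swap: "?g vs \<in> lin_lists A \<longleftrightarrow> ?f vs \<in> lin_lists A" for vs
  proof -
    have "\<not> a \<le> o'" "\<not> b \<le> o'"
      using bottom mem distinct by (auto dest: antisym)
    then show ?thesis
      using lin_lists_window_iff[of "[]" o' a b vs A o' b a]
        lin_lists_window_iff[of "[]" o' b a vs A o' a b] incomp by auto
  qed
  have cases: "(\<exists>vs. xs = ?f vs) \<or> (\<exists>vs. xs = ?g vs) \<or> (d, a) \<in> list_rel xs \<and> (b, a) \<in> list_rel xs"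
    if xs: "xs \<in> lin_lists A" for xs
  proof -
    have "card {o', a, b, d} \<le> length xs"
      using card_mono[OF fin mem] lin_lists_length[OF xs] by simp
    then have "length xs \<ge> 3" using distinct by simp
    then obtain x y z ws where e: "xs = x # y # z # ws"
      by (auto simp: numeral_3_eq_3 Suc_le_length_iff)
    have A: "A = {x, y, z} \<union> set ws" and s: "\<forall>w\<in>{y, z} \<union> set ws. \<not> w \<le> x"
      "\<forall>w\<in>{z} \<union> set ws. \<not> w \<le> y" "\<forall>w\<in>set ws. \<not> w \<le> z"
      using xs e by (auto simp: lin_lists_def)
    have x: "x = o'" using A s(1) mem bottom[of x] by blast
    have y: "y = a \<or> y = b"
      using A s(1,2) x mem distinct above_b[of y] by auto
    show ?thesis
    proof (cases "y = a")
      case True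
      then have "z = b"
        using A s x mem distinct above_b[of z] lin_lists_distinct[OF xs] e by auto
      with True x e show ?thesis by blast
    next
      case False
      with y have y: "y = b" by simp
      \<comment> \<open>Every cell still available is above \<open>a\<close> or \<open>d\<close>. If
        \<open>d\<close> is third, then \<open>a\<close> comes after both \<open>b\<close> and
        \<open>d\<close>.\<close>
      then have "z = a \<or> z = d"
        using A s x mem distinct above_a_or_d[of z] lin_lists_distinct[OF xs] e by auto
      then show ?thesis
        using x y e A mem distinct by auto
    qed
  qed
  have asym: "(v, u) \<notin> list_rel xs" if "(u, v) \<in> list_rel xs" "u \<noteq> v" "xs \<in> lin_lists A" for u v xs
    using linear_order_list_rel[OF lin_lists_distinct[OF that(3)]] that(1,2)
    by (auto simp: order_on_defs antisym_def)
  have in_set: "d \<in> set xs" "b \<in> set xs" "a \<in> set xs" if "xs \<in> lin_lists A" for xs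
    using that mem by (auto simp: lin_lists_def)
  have "{xs \<in> lin_lists A. (a, b) \<in> list_rel xs} = ?f ` ?P"
  proof (intro subset_antisym subsetI)
    fix xs assume "xs \<in> {xs \<in> lin_lists A. (a, b) \<in> list_rel xs}"
    then have xs: "xs \<in> lin_lists A" "(b, a) \<notin> list_rel xs"
      using asym distinct by auto
    then show "xs \<in> ?f ` ?P" using cases[OF xs(1)] by auto
  qed auto
  moreover have "{xs \<in> lin_lists A. (a, d) \<in> list_rel xs} = ?f ` ?P \<union> ?g ` ?P"
  proof (intro subset_antisym subsetI)
    fix xs assume "xs \<in> {xs \<in> lin_lists A. (a, d) \<in> list_rel xs}"
    then have xs: "xs \<in> lin_lists A" "(d, a) \<notin> list_rel xs"
      using asym distinct by auto
    then show "xs \<in> ?f ` ?P \<union> ?g ` ?P"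
      using cases[OF xs(1)] swap by auto
  next
    fix xs assume "xs \<in> ?f ` ?P \<union> ?g ` ?P"
    then have xs: "xs \<in> lin_lists A" "(\<exists>vs. xs = ?f vs) \<or> (\<exists>vs. xs = ?g vs)"
      using swap by auto
    then show "xs \<in> {xs \<in> lin_lists A. (a, d) \<in> list_rel xs}"
      using in_set[OF xs(1)] distinct by auto
  qed
  moreover have "finite ?P"
    by (rule inj_on_finite[OF _ _ finite_lin_lists[OF fin], of ?f]) (auto simp: inj_on_def)
  moreover have "?f ` ?P \<inter> ?g ` ?P = {}"
    using distinct by auto
  ultimately show ?thesis
    by (simp add: card_Un_disjoint card_image inj_on_def)
qed

section \<open>Numerical bounds\<close>

text \<open>The equation says that \<open>2 * X / f\<close> is \<open>(k + 1) / (2 * k - 1)\<close>;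
  for \<open>k \<ge> 6\<close> this ratio lies between 1/3 and 2/3.\<close>

lemma two_rows_arith:
  fixes k f X :: int
  assumes "(2 * k - 1) * (f - 2 * X) = (k - 2) * f" "k \<ge> 6" "f \<ge> 0"
  shows "f \<le> 3 * (2 * X)" "3 * (2 * X) \<le> 2 * f"
proof -
  have two_X: "(2 * k - 1) * (2 * X) = (k + 1) * f"
    using assms(1) by (simp add: algebra_simps)
  have pos: "0 < 2 * k - 1"
    using assms(2) by simp
  have eq: "(2 * k - 1) * (3 * (2 * X)) = (3 * (k + 1)) * f"
    by (simp only: mult.left_commute[of _ 3] two_X mult.assoc)
  have "(2 * k - 1) * f \<le> (3 * (k + 1)) * f"
    using assms(2,3) by (intro mult_right_mono) simp_all
  then show "f \<le> 3 * (2 * X)"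
    unfolding eq[symmetric] using pos by (rule mult_left_le_imp_le)
  have "(3 * (k + 1)) * f \<le> (2 * (2 * k - 1)) * f"
    using assms(2,3) by (intro mult_right_mono) simp_all
  also have "\<dots> = (2 * k - 1) * (2 * f)"
    by simp
  finally show "3 * (2 * X) \<le> 2 * f"
    unfolding eq[symmetric] using pos by (rule mult_left_le_imp_le)
qed

lemma abs_diff_le_prod:
  fixes a b :: int
  assumes "a \<ge> 3" "b \<ge> 3"
  shows "3 * \<bar>b - a\<bar> \<le> a * b - 1"
proof -
  \<comment> \<open>Naming the product makes it an atom for linear arithmetic: the larger factor
    times 3 is at most \<open>t\<close>, and subtracting 3 times the smaller leaves room for the
    1.\<close>
  define t where "t = a * b"
  have "3 * b \<le> t" "3 * a \<le> t"
    unfolding t_def using assms mult_right_mono[of 3 a b] mult_right_mono[of 3 b a]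
    by (simp_all add: mult.commute)
  moreover have "\<bar>b - a\<bar> = b - a \<or> \<bar>b - a\<bar> = a - b"
    by (simp add: abs_if)
  ultimately show ?thesis
    unfolding t_def[symmetric] using assms by auto
qed

section \<open>Choice of the balanced pair\<close>

theorem theorem3p8:
  fixes m n :: nat
  assumes "m \<ge> 2" and "n \<ge> 2"
  shows "\<exists>x y. third_balanced_pair (chain m \<times> chain n) (chain_prod_order m n) x y"
proof -
  let ?A = "chain m \<times> chain n" and ?a = "(1, 0) :: nat \<times> nat" and ?b = "(0, 1) :: nat \<times> nat"
  let ?before = "\<lambda>x y. {xs \<in> lin_lists ?A. (x, y) \<in> list_rel xs}"
  define f where "f = card (lin_lists ?A)"
  define X where "X = card (?before ?a ?b)"
  define Y where "Y = card (?before ?b ?a)"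
  have "f > 0"
    using lin_lists_nonempty[of ?A] finite_lin_lists[of ?A] by (simp add: f_def card_gt_0_iff)
  have balanced: "third_balanced_pair ?A (chain_prod_order m n) x y \<longleftrightarrow>
      x \<in> ?A \<and> y \<in> ?A \<and> x \<noteq> y \<and> f \<le> 3 * card (?before x y) \<and> 3 * card (?before x y) \<le> 2 * f" for x y
  proof -
    have "1 / 3 \<le> real c / real f \<longleftrightarrow> f \<le> 3 * c" "real c / real f \<le> 2 / 3 \<longleftrightarrow> 3 * c \<le> 2 * f" for c
      using \<open>f > 0\<close> by (auto simp: field_simps)
    then show ?thesis
      by (simp add: third_balanced_pair_def chain_prod_order_def prob_before_lin_lists flip: f_def)
  qed
  have XY: "X + Y = f"
    and YX: "(int m * int n - 1) * (int Y - int X) = (int n - int m) * int f"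
    using card_lin_lists_chain_prod[OF assms] by (simp_all add: f_def X_def Y_def)
  \<comment> \<open>For \<open>m = 2\<close> the first alternative reads
    \<open>3 * (n - 2) \<le> 2 * n - 1\<close>, that is \<open>n \<le> 5\<close>; hence the
    threshold 6.\<close>
  consider "3 * \<bar>int n - int m\<bar> \<le> int m * int n - 1" | "m = 2" "n \<ge> 6" | "n = 2" "m \<ge> 6"
  proof -
    consider "m \<ge> 3" "n \<ge> 3" | "m = 2" "n < 6" | "n = 2" "m < 6" | "m = 2" "n \<ge> 6" | "n = 2" "m \<ge> 6"
      using assms by linarith
    then show ?thesis
    proof cases
      case 1
      then show ?thesis by (intro that(1) abs_diff_le_prod) simp_all
    next
      case 2
      then have "n = 2 \<or> n = 3 \<or> n = 4 \<or> n = 5" using assms by auto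
      with 2 show ?thesis by (intro that(1)) auto
    next
      case 3
      then have "m = 2 \<or> m = 3 \<or> m = 4 \<or> m = 5" using assms by auto
      with 3 show ?thesis by (intro that(1)) auto
    next
      case 4
      then show ?thesis by (rule that(2))
    next
      case 5
      then show ?thesis by (rule that(3))
    qed
  qed
  then show ?thesis
  proof cases
    case 1
    have "int (2 * 2) \<le> int (m * n)"
      using mult_le_mono[OF assms] by (simp only: of_nat_le_iff)
    then have pos: "int m * int n - 1 > 0" by simp
    then have "(int m * int n - 1) * (3 * \<bar>int Y - int X\<bar>) = 3 * \<bar>int n - int m\<bar> * int f"
      using arg_cong[OF YX, of abs] by (simp add: abs_mult)
    also have "\<dots> \<le> (int m * int n - 1) * int f"
      using 1 by (intro mult_right_mono) auto
    finally have "3 * \<bar>int Y - int X\<bar> \<le> int f"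
      using pos by simp
    moreover have "3 * z \<le> k \<and> 3 * (- z) \<le> k" if "3 * \<bar>z\<bar> \<le> k" for z k :: int
      using that by (simp add: abs_if split: if_splits)
    ultimately have "3 * (int Y - int X) \<le> int f \<and> 3 * (- (int Y - int X)) \<le> int f"
      by blast
    \<comment> \<open>As \<open>X + Y = f\<close>, a difference of at most \<open>f / 3\<close>
      places \<open>X\<close> between \<open>f / 3\<close> and \<open>2 * f / 3\<close>.\<close>
    then have "f \<le> 3 * X" "3 * X \<le> 2 * f"
      unfolding XY[symmetric] by simp_all
    then have "third_balanced_pair ?A (chain_prod_order m n) ?a ?b"
      unfolding balanced X_def[symmetric] using assms by (simp add: chain_def)
    then show ?thesis by blast
  next
    case 2
    have "card (?before ?a (0, 2)) = 2 * X"
      unfolding X_def using 2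
      by (intro card_lin_lists_double[where o' = "(0, 0)"])
        (auto simp: chain_def less_eq_prod_def)
    moreover have "f \<le> 3 * (2 * X)" "3 * (2 * X) \<le> 2 * f"
    proof -
      have "int Y - int X = int f - 2 * int X"
        using XY by simp
      from YX[unfolded this] 2
      have "(2 * int n - 1) * (int f - 2 * int X) = (int n - 2) * int f"
        by simp
      from two_rows_arith[OF this] show "f \<le> 3 * (2 * X)" "3 * (2 * X) \<le> 2 * f"
        using 2 by simp_all
    qed
    ultimately have "third_balanced_pair ?A (chain_prod_order m n) ?a (0, 2)"
      unfolding balanced using 2 by (simp add: chain_def)
    then show ?thesis by blast
  next
    case 3
    have "card (?before ?b (2, 0)) = 2 * Y"
      unfolding Y_def using 3
      by (intro card_lin_lists_double[where o' = "(0, 0)"])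
        (auto simp: chain_def less_eq_prod_def)
    moreover have "f \<le> 3 * (2 * Y)" "3 * (2 * Y) \<le> 2 * f"
    proof -
      \<comment> \<open>Negating both differences in \<open>YX\<close> exchanges the two chains, so
        \<open>Y\<close> takes the place of \<open>X\<close> in the arithmetic.\<close>
      have e: "- (int Y - int X) = int f - 2 * int Y" "- (int n - int m) = int m - 2"
        using XY 3 by simp_all
      have "(int m * int n - 1) * - (int Y - int X) = - (int n - int m) * int f"
        unfolding mult_minus_right mult_minus_left YX ..
      then have "(2 * int m - 1) * (int f - 2 * int Y) = (int m - 2) * int f"
        unfolding e using 3 by (simp add: mult.commute)
      from two_rows_arith[OF this] show "f \<le> 3 * (2 * Y)" "3 * (2 * Y) \<le> 2 * f"
        using 3 by simp_all
    qed
    ultimately have "third_balanced_pair ?A (chain_prod_order m n) ?b (2, 0)"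
      unfolding balanced using 3 by (simp add: chain_def)
    then show ?thesis by blast
  qed
qed

end
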